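(* Let $\mathcal{A}$ be a countable alphabet, and let $X$ and $Y$ be shift spaces over $\mathcal{A}$. If $X$ is row-finite and $\phi:X\to Y$ is a function, then $\phi$ is a shift morphism if and only if $\phi$ is a sliding block code. Moreover, if $\phi$ is a bounded sliding block code, then $\phi$ is an $M$-block code for some $M\in\mathbb{N}$.
   Context: "Countable" means finite or countably infinite; $\mathbb{N}=\{1,2,\ldots\}$. For an alphabet $\mathcal{A}$, let $\mathcal{A}^0=\{\vec{0}\}$ ($\vec{0}$ the empty sequence), $\Sigma_{\mathcal{A}}^{\mathrm{fin}}=\bigcup_{k=0}^\infty\mathcal{A}^k$ and $\Sigma_{\mathcal{A}}^{\mathrm{inf}}=\mathcal{A}^{\mathbb{N}}$; $l(x)\in\{0,1,\ldots,\infty\}$ is the length. If $\mathcal{A}$ is infinite, $\Sigma_{\mathcal{A}}:=\Sigma_{\mathcal{A}}^{\mathrm{inf}}\sqcup\Sigma_{\mathcal{A}}^{\mathrm{fin}}$ with the quotient topology from the map $Q:\mathcal{A}_\infty\times\mathcal{A}_\infty\times\cdots\to\Sigma_{\mathcal{A}}$ that truncates a sequence just before the first occurrence of $\infty$, where $\mathcal{A}_\infty=\mathcal{A}\cup\{\infty\}$ is the one-point compactification of the discrete space $\mathcal{A}$ and the product has the product topology. If $\mathcal{A}$ is finite, $\Sigma_{\mathcal{A}}:=\mathcal{A}^{\mathbb{N}}$ with the product topology. The shift map $\sigma$ deletes the first entry, with $\sigma(x)=\vec 0$ when $l(x)\le 1$. A shift space over $\mathcal{A}$ is a closed set $X\subseteq\Sigma_{\mathcal{A}}$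 with $\sigma(X)\subseteq X$ having the infinite-extension property: for each $x\in X$ with $l(x)<\infty$ there are infinitely many $a\in\mathcal{A}$ with $xay\in X$ for some $y\in\Sigma_{\mathcal{A}}$. $X^{\mathrm{inf}}=X\cap\Sigma_{\mathcal{A}}^{\mathrm{inf}}$. $B(X)$ is the set of finite blocks occurring as subblocks of elements of $X$, and $B_n(X)=B(X)\cap\mathcal{A}^n$. $X$ is row-finite if for every $a\in\mathcal{A}$ the set $\{b\in\mathcal{A}:ab\in B(X)\}$ is finite. A shift morphism $\phi:X\to Y$ is a continuous map with $\phi\circ\sigma=\sigma\circ\phi$ and $l(\phi(x))=l(x)$ for all $x\in X$. Let $X$ be row-finite. A function $\phi:X\to Y$ is a sliding block code if: (a) whenever $\{x^n\}_{n=1}^\infty\subseteq X$ and $\lim_{n\to\infty}x^n=\vec{0}$, then $\lim_{n\to\infty}\phi(x^n)=\vec{0}$; and (b) for each $a\in\mathcal{A}$ there exist $n(a)\in\mathbb{N}$ and a function $\Phi^a:B_{n(a)}(X)\cap Z(a)\to\mathcal{A}$ (where $B_n(X)\cap Z(a)$ is the set of $n$-blocks of $X$ with first entry $a$) such that $\phi(x_1x_2x_3\ldots)_i=\Phi^{x_i}(x_i\ldots x_{n(x_i)+i-1})$ for all $i\in\mathbb{N}$ and all $x_1x_2x_3\ldots\in X^{\mathrm{inf}}$. It is bounded if (the $n(a)$ can be chosen so that) there exists $M\in\mathbb{N}$ with $n(a)\le M$ for all $a\in\mathcal{A}$, and unbounded otherwise. A sliding block code $\phi$ is an $M$-block code if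 there is a map $\Phi:B_M(X)\to\mathcal{A}$ with $\phi(x_1x_2x_3\ldots)_i=\Phi(x_i\ldots x_{M+i-1})$ for all $i\in\mathbb{N}$ and all $x_1x_2x_3\ldots\in X^{\mathrm{inf}}$. *)

theory Defs
  imports "HOL-Analysis.Analysis" "HOL-Library.Extended_Nat" "HOL-Library.Countable_Set"
begin

(* Finite and infinite sequences. Positions are counted from 0, so the entry written x_(i+1)
   in the literature has position i here. *)
datatype 'a seq = FinSeq "'a list" | InfSeq "nat \<Rightarrow> 'a"

fun slength :: "'a seq \<Rightarrow> enat" where
  "slength (FinSeq xs) = enat (length xs)"
| "slength (InfSeq x) = \<infinity>"

(* The entry at a position, None beyond the end of a finite sequence. *)
fun entry :: "'a seq \<Rightarrow> nat \<Rightarrow> 'a option" where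
  "entry (FinSeq xs) i = (if i < length xs then Some (xs ! i) else None)"
| "entry (InfSeq x) i = Some (x i)"

(* The concatenation of a finite block and a sequence. *)
fun sappend :: "'a list \<Rightarrow> 'a seq \<Rightarrow> 'a seq" where
  "sappend u (FinSeq ys) = FinSeq (u @ ys)"
| "sappend u (InfSeq y) = InfSeq (\<lambda>i. if i < length u then u ! i else y (i - length u))"

fun shift :: "'a seq \<Rightarrow> 'a seq" where
  "shift (FinSeq xs) = FinSeq (tl xs)"
| "shift (InfSeq x) = InfSeq (\<lambda>i. x (Suc i))"

(* The point at infinity of the one-point compactification is None. *)
definition truncate :: "(nat \<Rightarrow> 'a option) \<Rightarrow> 'a seq" where
  "truncate x = (if \<exists>i. x i = None
     then FinSeq (map (\<lambda>i. the (x i)) [0..<(LEAST i. x i = None)])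
     else InfSeq (\<lambda>i. the (x i)))"

definition quotient_topology :: "'b topology \<Rightarrow> ('b \<Rightarrow> 'c) \<Rightarrow> 'c topology" where
  "quotient_topology T q =
     topology (\<lambda>U. U \<subseteq> q ` topspace T \<and> openin T {x \<in> topspace T. q x \<in> U})"

lemma openin_quotient_topology:
  "openin (quotient_topology T q) U \<longleftrightarrow>
     U \<subseteq> q ` topspace T \<and> openin T {x \<in> topspace T. q x \<in> U}"
proof -
  have "istopology (\<lambda>U. U \<subseteq> q ` topspace T \<and> openin T {x \<in> topspace T. q x \<in> U})"
    unfolding istopology_def
  proof (intro conjI allI impI)
    fix S U
    assume S: "S \<subseteq> q ` topspace T \<and> openin T {x \<in> topspace T. q x \<in> S}"
      and U: "U \<subseteq> q ` topspace T \<and> openin T {x \<in> topspace T. q x \<in> U}"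
    show "S \<inter> U \<subseteq> q ` topspace T" using S by blast
    have "{x \<in> topspace T. q x \<in> S \<inter> U} =
        {x \<in> topspace T. q x \<in> S} \<inter> {x \<in> topspace T. q x \<in> U}" by blast
    then show "openin T {x \<in> topspace T. q x \<in> S \<inter> U}" using S U by auto
  next
    fix K
    assume K: "\<forall>S\<in>K. S \<subseteq> q ` topspace T \<and> openin T {x \<in> topspace T. q x \<in> S}"
    show "\<Union>K \<subseteq> q ` topspace T" using K by blast
    have "{x \<in> topspace T. q x \<in> \<Union>K} = (\<Union>S\<in>K. {x \<in> topspace T. q x \<in> S})" by blast
    then show "openin T {x \<in> topspace T. q x \<in> \<Union>K}" using K by auto
  qed
  then show ?thesis unfolding quotient_topology_def by simp
qed

lemma topspace_quotient_topology: "topspace (quotient_topology T q) = q ` topspace T"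
proof
  show "topspace (quotient_topology T q) \<subseteq> q ` topspace T"
    by (metis openin_quotient_topology openin_topspace)
  have "{x \<in> topspace T. q x \<in> q ` topspace T} = topspace T" by blast
  then have "openin (quotient_topology T q) (q ` topspace T)"
    by (simp add: openin_quotient_topology)
  then show "q ` topspace T \<subseteq> topspace (quotient_topology T q)"
    by (rule openin_subset)
qed

lemma quotient_map_quotient_topology: "quotient_map T (quotient_topology T q) q"
  unfolding quotient_map_def by (simp add: topspace_quotient_topology openin_quotient_topology)

(* InfSeq is injective, so for finite A this is a homeomorphic copy of the product space. *)
definition full_shift :: "'a set \<Rightarrow> 'a seq topology" where
  "full_shift A = (if finite A
     then quotient_topology (product_topology (\<lambda>_. discrete_topology A) UNIV) InfSeq
     else quotient_topology
       (product_topology (\<lambda>_. Alexandroff_compactification (discrete_topology A)) UNIV) truncate)"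

lemma homeomorphic_map_InfSeq:
  assumes "finite A"
  shows "homeomorphic_map (product_topology (\<lambda>_. discrete_topology A) UNIV) (full_shift A) InfSeq"
  using assms
  by (simp add: homeomorphic_map_def full_shift_def quotient_map_quotient_topology inj_on_def)

lemma topspace_full_shift_finite:
  assumes "finite A"
  shows "topspace (full_shift A) = {InfSeq x |x. range x \<subseteq> A}"
  using assms by (auto simp: full_shift_def topspace_quotient_topology PiE_UNIV_domain)

lemma topspace_full_shift_infinite:
  assumes "infinite A"
  shows "topspace (full_shift A) = {InfSeq x |x. range x \<subseteq> A} \<union> {FinSeq u |u. set u \<subseteq> A}"
proof -
  let ?P = "{x :: nat \<Rightarrow> 'a option. \<forall>i. x i \<in> insert None (Some ` A)}"
  have P: "topspace (full_shift A) = truncate ` ?P"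
    using assms
    by (auto simp: full_shift_def topspace_quotient_topology PiE_UNIV_domain)
  have "truncate x \<in> {InfSeq x |x. range x \<subseteq> A} \<union> {FinSeq u |u. set u \<subseteq> A}" if x: "x \<in> ?P" for x
  proof -
    have the: "the (x i) \<in> A" if "x i \<noteq> None" for i
    proof -
      have "x i \<in> insert None (Some ` A)" using x by blast
      then show ?thesis using that by auto
    qed
    show ?thesis
      by (auto simp: truncate_def dest: not_less_Least intro!: the)
  qed
  moreover have "InfSeq x \<in> truncate ` ?P" if "range x \<subseteq> A" for x
  proof
    show "InfSeq x = truncate (Some \<circ> x)" by (simp add: truncate_def)
    show "Some \<circ> x \<in> ?P" using that by auto
  qed
  moreover have "FinSeq u \<in> truncate ` ?P" if "set u \<subseteq> A" for u
  proof
    let ?x = "entry (FinSeq u)"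
    have L: "(LEAST i. ?x i = None) = length u" 
      by (rule Least_equality) (auto split: if_splits)
    have E: "\<exists>i. ?x i = None" by (rule exI[of _ "length u"]) simp
    show "FinSeq u = truncate ?x"
      unfolding truncate_def L using E by (auto intro!: nth_equalityI)
    show "?x \<in> ?P" using that by (auto simp: image_iff)
  qed
  ultimately show ?thesis unfolding P by blast
qed

definition shift_space :: "'a set \<Rightarrow> 'a seq set \<Rightarrow> bool" where
  "shift_space A X \<longleftrightarrow>
     closedin (full_shift A) X \<and>
     shift ` X \<subseteq> X \<and>
     (\<forall>u. FinSeq u \<in> X \<longrightarrow>
        infinite {a \<in> A. \<exists>y \<in> topspace (full_shift A). sappend (u @ [a]) y \<in> X})"

definition blocks :: "'a seq set \<Rightarrow> 'a list set" where
  "blocks X = {u. \<exists>v z. sappend (v @ u) z \<in> X}"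

definition n_blocks :: "nat \<Rightarrow> 'a seq set \<Rightarrow> 'a list set" where
  "n_blocks n X = {u \<in> blocks X. length u = n}"

definition row_finite :: "'a set \<Rightarrow> 'a seq set \<Rightarrow> bool" where
  "row_finite A X \<longleftrightarrow> (\<forall>a \<in> A. finite {b \<in> A. [a, b] \<in> blocks X})"

definition shift_morphism ::
    "'a set \<Rightarrow> 'a seq set \<Rightarrow> 'a seq set \<Rightarrow> ('a seq \<Rightarrow> 'a seq) \<Rightarrow> bool" where
  "shift_morphism A X Y \<phi> \<longleftrightarrow>
     continuous_map (subtopology (full_shift A) X) (subtopology (full_shift A) Y) \<phi> \<and>
     (\<forall>x \<in> X. \<phi> (shift x) = shift (\<phi> x)) \<and>
     (\<forall>x \<in> X. slength (\<phi> x) = slength x)"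

(* If A is finite, the empty sequence is not a point of the full shift and never a limit. *)
definition preserves_limits_to_empty ::
    "'a set \<Rightarrow> 'a seq set \<Rightarrow> ('a seq \<Rightarrow> 'a seq) \<Rightarrow> bool" where
  "preserves_limits_to_empty A X \<phi> \<longleftrightarrow>
     (\<forall>xs :: nat \<Rightarrow> 'a seq. range xs \<subseteq> X \<longrightarrow>
        limitin (full_shift A) xs (FinSeq []) sequentially \<longrightarrow>
        limitin (full_shift A) (\<lambda>n. \<phi> (xs n)) (FinSeq []) sequentially)"

(* The block of k entries of x starting at position i. *)
definition window :: "(nat \<Rightarrow> 'a) \<Rightarrow> nat \<Rightarrow> nat \<Rightarrow> 'a list" where
  "window x i k = map x [i..<i + k]"

definition local_rule ::
    "'a set \<Rightarrow> 'a seq set \<Rightarrow> ('a seq \<Rightarrow> 'a seq) \<Rightarrow> ('a \<Rightarrow> nat) \<Rightarrow> ('a \<Rightarrow> 'a list \<Rightarrow> 'a) \<Rightarrow> bool"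
  where
  "local_rule A X \<phi> n \<Phi> \<longleftrightarrow>
     (\<forall>a \<in> A. n a \<ge> 1 \<and> \<Phi> a \<in> {u \<in> n_blocks (n a) X. hd u = a} \<rightarrow> A) \<and>
     (\<forall>x. InfSeq x \<in> X \<longrightarrow>
        (\<forall>i. entry (\<phi> (InfSeq x)) i = Some (\<Phi> (x i) (window x i (n (x i))))))"

definition sliding_block_code ::
    "'a set \<Rightarrow> 'a seq set \<Rightarrow> ('a seq \<Rightarrow> 'a seq) \<Rightarrow> bool" where
  "sliding_block_code A X \<phi> \<longleftrightarrow>
     preserves_limits_to_empty A X \<phi> \<and> (\<exists>n \<Phi>. local_rule A X \<phi> n \<Phi>)"

definition bounded_sliding_block_code ::
    "'a set \<Rightarrow> 'a seq set \<Rightarrow> ('a seq \<Rightarrow> 'a seq) \<Rightarrow> bool" where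
  "bounded_sliding_block_code A X \<phi> \<longleftrightarrow>
     preserves_limits_to_empty A X \<phi> \<and>
     (\<exists>n \<Phi> M. local_rule A X \<phi> n \<Phi> \<and> M \<ge> 1 \<and> (\<forall>a \<in> A. n a \<le> M))"

definition block_code ::
    "'a set \<Rightarrow> 'a seq set \<Rightarrow> nat \<Rightarrow> ('a seq \<Rightarrow> 'a seq) \<Rightarrow> bool" where
  "block_code A X M \<phi> \<longleftrightarrow>
     sliding_block_code A X \<phi> \<and>
     (\<exists>\<Phi>. \<Phi> \<in> n_blocks M X \<rightarrow> A \<and>
        (\<forall>x. InfSeq x \<in> X \<longrightarrow>
           (\<forall>i. entry (\<phi> (InfSeq x)) i = Some (\<Phi> (window x i M)))))"

end

theory Submission
  imports Defs
begin

text \<open>Since \<open>X\<close> is row-finite, the infinite-extension property leaves the empty sequence as its only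
  possible finite point. If \<open>\<phi>\<close> is a morphism, the first entry of \<open>\<phi> x\<close> is locally constant in
  infinite \<open>x\<close>, hence determined by a window of fixed length on the compact set of points of \<open>X\<close>
  starting with \<open>a\<close>; commuting with the shift gives the rule at all positions. Conversely, a local
  rule makes \<open>\<phi>\<close> continuous at infinite points, and at the empty sequence \<open>\<phi>\<close> is continuous because
  it preserves limits of sequences and the alphabet is countable.\<close>

section \<open>Neighbourhoods in the full shift\<close>

text \<open>Replaces the \<open>LEAST\<close> in \<open>truncate\<close> by a condition on
  coordinates up to \<open>i\<close>, so that preimages of sets given by entries become open sets of
  the product.\<close>

lemma entry_truncate: "entry (truncate y) i = (if \<exists>j\<le>i. y j = None then None else y i)"
proof (cases "\<exists>j. y j = None")
  case True
  define L where "L = (LEAST j. y j = None)"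
  have L: "y L = None" unfolding L_def by (rule LeastI_ex[OF True])
  have less: "y j \<noteq> None" if "j < L" for j
    using that not_less_Least[of j "\<lambda>j. y j = None"] unfolding L_def by simp
  have "entry (truncate y) i = (if i < L then Some (the (y i)) else None)"
    using True by (simp add: truncate_def flip: L_def)
  moreover have "(\<exists>j\<le>i. y j = None) \<longleftrightarrow> \<not> i < L"
    using L less by (metis le_less_trans not_le)
  ultimately show ?thesis using less by auto
next
  case False
  then have "y = (\<lambda>i. Some (the (y i)))" by (intro ext) force
  then obtain f where "y = (\<lambda>i. Some (f i))" by (rule that)
  then show ?thesis by (simp add: truncate_def)
qed

lemma seq_eqI:
  assumes "\<And>i. entry x i = entry y i"
  shows "x = y"
proof -
  \<comment> \<open>The first position without an entry bounds the length; using this in both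
    directions gives equal lengths.\<close>
  have len: "slength s \<le> slength t" if "\<And>i. entry s i = entry t i" for s t :: "'a seq"
  proof (cases t)
    case (FinSeq v)
    then have "entry s (length v) = None" using that by simp
    then show ?thesis using FinSeq by (cases s) (auto split: if_splits)
  qed simp
  have "slength x = slength y" using len[of x y] len[of y x] assms by simp
  show ?thesis
  proof (cases x)
    case (FinSeq u)
    then obtain v where "y = FinSeq v" "length u = length v"
      using \<open>slength x = slength y\<close> by (cases y) auto
    moreover have "u ! i = v ! i" if "i < length u" for i
      using assms[of i] that calculation FinSeq by simp
    ultimately show ?thesis using FinSeq by (simp add: nth_equalityI)
  next
    case (InfSeq f)
    then obtain g where "y = InfSeq g"
      using \<open>slength x = slength y\<close> by (cases y) auto
    then show ?thesis using InfSeq assms by (simp add: fun_eq_iff)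
  qed
qed

text \<open>Padding with the point at infinity provides a canonical preimage in the product for
  every sequence.\<close>

lemma truncate_entry: "truncate (entry z) = z"
  by (rule seq_eqI, cases z) (auto simp: entry_truncate)

lemma entry_in_alphabet:
  assumes "z \<in> topspace (full_shift A)" "entry z i = Some b"
  shows "b \<in> A"
proof -
  consider x where "z = InfSeq x" "range x \<subseteq> A" | u where "z = FinSeq u" "set u \<subseteq> A"
    using assms(1)
    by (cases "finite A") (auto simp: topspace_full_shift_finite topspace_full_shift_infinite)
  then show ?thesis
  proof cases
    case 1
    then show ?thesis using assms(2) by auto
  next
    case 2
    then show ?thesis using assms(2) by (auto split: if_splits simp: subset_iff)
  qed
qed

lemma InfSeq_in_full_shift: "InfSeq x \<in> topspace (full_shift A) \<longleftrightarrow> range x \<subseteq> A"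
  by (cases "finite A") (auto simp: topspace_full_shift_finite topspace_full_shift_infinite)

lemma openin_Alexandroff_isolated_point:
  assumes "a \<in> A"
  shows "openin (Alexandroff_compactification (discrete_topology A)) {Some a}"
  using openin_Alexandroff_compactification_image_Some[of "discrete_topology A" "{a}"] assms
  by simp

lemma openin_entry_eq:
  assumes "b \<in> A"
  shows "openin (full_shift A) {z \<in> topspace (full_shift A). entry z i = Some b}"
proof (cases "finite A")
  case True
  let ?P = "product_topology (\<lambda>_. discrete_topology A) (UNIV :: nat set)"
  have "openin ?P {y \<in> topspace ?P. y i \<in> {b}}"
    by (rule openin_continuous_map_preimage[OF continuous_map_product_projection])
      (use assms in auto)
  moreover have "{y \<in> topspace ?P. InfSeq y \<in> {z \<in> InfSeq ` topspace ?P. entry z i = Some b}}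
      = {y \<in> topspace ?P. y i \<in> {b}}" by auto
  ultimately show ?thesis
    using True
    by (simp only: full_shift_def if_True topspace_quotient_topology openin_quotient_topology) auto
next
  case False
  let ?K = "Alexandroff_compactification (discrete_topology A)"
  let ?P = "product_topology (\<lambda>_. ?K) (UNIV :: nat set)"
  have coord: "openin ?P {y \<in> topspace ?P. y j \<in> U}" if "openin ?K U" for j U
    by (rule openin_continuous_map_preimage[OF continuous_map_product_projection])
      (use that in auto)
  \<comment> \<open>All coordinates before \<open>i\<close> must be letters as well, since
    truncation would otherwise remove entry \<open>i\<close>. These are finitely many open
    conditions on single coordinates.\<close>
  have "openin ?P ((\<Inter>j\<in>{..i}. {y \<in> topspace ?P. y j \<in> Some ` A}) \<inter>
      {y \<in> topspace ?P. y i \<in> Some ` {b}})"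
    by (intro openin_Int openin_INT2 coord)
      (use assms in \<open>auto simp: openin_Alexandroff_isolated_point\<close>)
  also have "(\<Inter>j\<in>{..i}. {y \<in> topspace ?P. y j \<in> Some ` A}) \<inter>
      {y \<in> topspace ?P. y i \<in> Some ` {b}} =
      {y \<in> topspace ?P. truncate y \<in> {z \<in> truncate ` topspace ?P. entry z i = Some b}}"
    (is "?l = ?r")
  proof -
    have "(\<forall>j\<in>{..i}. y j \<in> Some ` A) \<and> y i \<in> Some ` {b} \<longleftrightarrow> entry (truncate y) i = Some b"
      if y: "y \<in> topspace ?P" for y
    proof -
      have "y j \<in> insert None (Some ` A)" for j using y by (auto simp: PiE_UNIV_domain)
      then have "y j \<in> Some ` A \<longleftrightarrow> y j \<noteq> None" for j by (metis imageE insertE option.simps(3))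
      then show ?thesis by (auto simp: entry_truncate)
    qed
    then show ?thesis by blast
  qed
  finally show ?thesis
    using False
    by (simp only: full_shift_def if_False topspace_quotient_topology openin_quotient_topology) auto
qed

lemma openin_cylinder:
  assumes "range x \<subseteq> A"
  shows "openin (full_shift A)
    {z \<in> topspace (full_shift A). \<forall>i<n. entry z i = Some (x i)}"
proof (induction n)
  case (Suc n)
  have "openin (full_shift A) ({z \<in> topspace (full_shift A). \<forall>i<n. entry z i = Some (x i)} \<inter>
      {z \<in> topspace (full_shift A). entry z n = Some (x n)})"
    by (intro openin_Int Suc openin_entry_eq) (use assms in auto)
  also have "{z \<in> topspace (full_shift A). \<forall>i<n. entry z i = Some (x i)} \<inter>
      {z \<in> topspace (full_shift A). entry z n = Some (x n)} =
      {z \<in> topspace (full_shift A). \<forall>i<Suc n. entry z i = Some (x i)}"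
    by (auto simp: less_Suc_eq)
  finally show ?case .
qed simp

text \<open>Complements of finite sets of letters are neighbourhoods of the point at infinity, so
  these sets are neighbourhoods of the empty sequence, which has no first entry.\<close>

lemma openin_first_entry_avoids:
  assumes "infinite A" "finite F" "F \<subseteq> A"
  shows "openin (full_shift A) {z \<in> topspace (full_shift A). entry z 0 \<notin> Some ` F}"
proof -
  let ?K = "Alexandroff_compactification (discrete_topology A)"
  let ?P = "product_topology (\<lambda>_. ?K) (UNIV :: nat set)"
  have "compactin (discrete_topology A) F" "closedin (discrete_topology A) F"
    using assms by (auto simp: closedin_def finite_imp_compactin)
  then have "openin ?K (insert None (Some ` (A - F)))"
    by (force simp: openin_Alexandroff_compactification)
  then have "openin ?P {y \<in> topspace ?P. y 0 \<in> insert None (Some ` (A - F))}"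
    by (rule openin_continuous_map_preimage[OF continuous_map_product_projection[OF UNIV_I]])
  also have "{y \<in> topspace ?P. y 0 \<in> insert None (Some ` (A - F))} =
      {y \<in> topspace ?P. truncate y \<in> {z \<in> truncate ` topspace ?P. entry z 0 \<notin> Some ` F}}"
  proof -
    have "y 0 \<in> insert None (Some ` (A - F)) \<longleftrightarrow> entry (truncate y) 0 \<notin> Some ` F"
      if y: "y \<in> topspace ?P" for y
    proof -
      have "y 0 \<in> insert None (Some ` A)" using y by (auto simp: PiE_UNIV_domain)
      then show ?thesis by (auto simp: entry_truncate)
    qed
    then show ?thesis by blast
  qed
  finally show ?thesis
    using assms(1)
    by (simp only: full_shift_def if_False topspace_quotient_topology openin_quotient_topology) auto
qed

lemma openin_product_contains_cylinder:
  assumes "openin (product_topology T (UNIV :: nat set)) V" "x \<in> V"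
  shows "\<exists>n. \<forall>y \<in> topspace (product_topology T UNIV). (\<forall>i<n. y i = x i) \<longrightarrow> y \<in> V"
proof -
  obtain U where U: "finite {i. U i \<noteq> topspace (T i)}" "x \<in> Pi\<^sub>E UNIV U" "Pi\<^sub>E UNIV U \<subseteq> V"
    using assms unfolding openin_product_topology_alt by auto
  \<comment> \<open>A basic box constrains only finitely many coordinates; \<open>n\<close> exceeds
    all of them.\<close>
  then obtain n where "{i. U i \<noteq> topspace (T i)} \<subseteq> {..<n}"
    by (auto simp: finite_nat_iff_bounded)
  then have n: "\<And>i. U i \<noteq> topspace (T i) \<Longrightarrow> i < n" by blast
  have "y \<in> V" if y: "y \<in> topspace (product_topology T UNIV)" "\<forall>i<n. y i = x i" for y
  proof -
    have "y i \<in> U i" for i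
    proof (cases "i < n")
      case True
      then show ?thesis using y(2) U(2) by (auto simp: PiE_UNIV_domain)
    next
      case False
      then have "U i = topspace (T i)" using n by blast
      then show ?thesis using y(1) by (auto simp: PiE_UNIV_domain)
    qed
    then show ?thesis using U(3) by (auto simp: PiE_UNIV_domain)
  qed
  then show ?thesis by blast
qed

text \<open>Openness in the quotient is tested on the preimage in the product. For infinite
  \<open>A\<close> the preimage \<open>entry z\<close> of \<open>z\<close> is used, because it
  inherits the agreement of \<open>z\<close> with \<open>x\<close>.\<close>

lemma openin_contains_cylinder:
  assumes "openin (full_shift A) U" "InfSeq x \<in> U"
  shows "\<exists>n. \<forall>z \<in> topspace (full_shift A). (\<forall>i<n. entry z i = Some (x i)) \<longrightarrow> z \<in> U"
proof (cases "finite A")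
  case True
  let ?P = "product_topology (\<lambda>_. discrete_topology A) (UNIV :: nat set)"
  have "InfSeq x \<in> topspace (full_shift A)" using openin_subset[OF assms(1)] assms(2) by blast
  then have x: "range x \<subseteq> A" by (simp only: InfSeq_in_full_shift)
  have V: "openin ?P {y \<in> topspace ?P. InfSeq y \<in> U}"
    using assms(1) True by (simp add: full_shift_def openin_quotient_topology)
  have "x \<in> {y \<in> topspace ?P. InfSeq y \<in> U}"
    using x assms(2) by (auto simp: PiE_UNIV_domain)
  from openin_product_contains_cylinder[OF V this] obtain n
    where n: "\<And>y. y \<in> topspace ?P \<Longrightarrow> (\<forall>i<n. y i = x i) \<Longrightarrow> InfSeq y \<in> U"
    by auto
  have "z \<in> U" if "z \<in> topspace (full_shift A)" "\<forall>i<n. entry z i = Some (x i)" for z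
    using that True by (auto simp: topspace_full_shift_finite PiE_UNIV_domain image_subset_iff
        intro!: n)
  then show ?thesis by blast
next
  case False
  let ?P = "product_topology
    (\<lambda>_. Alexandroff_compactification (discrete_topology A)) (UNIV :: nat set)"
  have "InfSeq x \<in> topspace (full_shift A)" using openin_subset[OF assms(1)] assms(2) by blast
  then have x: "range x \<subseteq> A" by (simp only: InfSeq_in_full_shift)
  have V: "openin ?P {y \<in> topspace ?P. truncate y \<in> U}"
    using assms(1) False by (simp add: full_shift_def openin_quotient_topology)
  have "Some \<circ> x \<in> {y \<in> topspace ?P. truncate y \<in> U}"
    using x assms(2) by (auto simp: PiE_UNIV_domain truncate_def)
  from openin_product_contains_cylinder[OF V this] obtain n
    where n: "\<And>y. y \<in> topspace ?P \<Longrightarrow> (\<forall>i<n. y i = Some (x i)) \<Longrightarrow> truncate y \<in> U"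
    by auto
  have "z \<in> U" if z: "z \<in> topspace (full_shift A)" "\<forall>i<n. entry z i = Some (x i)" for z
  proof -
    have "entry z i \<in> insert None (Some ` A)" for i
      using entry_in_alphabet[OF z(1), of i] by (cases "entry z i") auto
    then have "entry z \<in> topspace ?P" by (auto simp: PiE_UNIV_domain)
    then show ?thesis using n[of "entry z"] z(2) by (simp add: truncate_entry)
  qed
  then show ?thesis by blast
qed

text \<open>The complement of the neighbourhood is compact, so its projection to the first coordinate
  is a compact set that misses the point at infinity.\<close>
lemma openin_contains_empty:
  assumes "openin (full_shift A) U" "FinSeq [] \<in> U"
  shows "\<exists>F. finite F \<and> F \<subseteq> A \<and>
    (\<forall>z \<in> topspace (full_shift A). entry z 0 \<notin> Some ` F \<longrightarrow> z \<in> U)"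
proof -
  \<comment> \<open>Over a finite alphabet the empty sequence is not a point of the full
    shift.\<close>
  have inf: "infinite A"
    using assms openin_subset[OF assms(1)] by (auto simp: topspace_full_shift_finite)
  let ?K = "Alexandroff_compactification (discrete_topology A)"
  let ?P = "product_topology (\<lambda>_. ?K) (UNIV :: nat set)"
  define C where "C = topspace ?P - {y \<in> topspace ?P. truncate y \<in> U}"
  have "openin ?P {y \<in> topspace ?P. truncate y \<in> U}"
    using assms(1) inf by (simp add: full_shift_def openin_quotient_topology)
  then have "closedin ?P C" unfolding C_def by blast
  moreover have "compact_space ?P" by (simp add: compact_space_product_topology)
  ultimately have "compactin ?P C" by (rule closedin_compact_space[rotated])
  then have cpt: "compactin ?K ((\<lambda>y. y 0) ` C)"
    by (rule image_compactin[OF _ continuous_map_product_projection[OF UNIV_I]])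
  have "y 0 \<noteq> None" if "y \<in> C" for y
  proof
    assume "y 0 = None"
    then have "truncate y = FinSeq []"
      by (intro seq_eqI) (auto simp: entry_truncate)
    then show False using that assms(2) by (simp add: C_def)
  qed
  moreover have "y 0 \<in> insert None (Some ` A)" if "y \<in> C" for y
    using that by (auto simp: C_def PiE_UNIV_domain)
  ultimately have sub: "(\<lambda>y. y 0) ` C \<subseteq> Some ` A" by blast
  \<comment> \<open>The projection of \<open>C\<close> is covered by isolated points; the letters of
    a finite subcover form \<open>F\<close>.\<close>
  have "\<exists>\<F>. finite \<F> \<and> \<F> \<subseteq> (\<lambda>a. {Some a}) ` A \<and> (\<lambda>y. y 0) ` C \<subseteq> \<Union>\<F>"
  proof (rule compactinD[OF cpt])
    show "openin ?K W" if "W \<in> (\<lambda>a. {Some a}) ` A" for W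
      using that by (auto intro: openin_Alexandroff_isolated_point)
    show "(\<lambda>y. y 0) ` C \<subseteq> \<Union> ((\<lambda>a. {Some a}) ` A)" using sub by auto
  qed
  then obtain F where F: "finite F" "F \<subseteq> A" "(\<lambda>y. y 0) ` C \<subseteq> (\<Union>a\<in>F. {Some a})"
    by (metis (no_types, lifting) finite_subset_image)
  have "z \<in> U" if z: "z \<in> topspace (full_shift A)" "entry z 0 \<notin> Some ` F" for z
  proof -
    have "entry z i \<in> insert None (Some ` A)" for i
      using entry_in_alphabet[OF z(1), of i] by (cases "entry z i") auto
    then have "entry z \<in> topspace ?P" by (auto simp: PiE_UNIV_domain)
    moreover have "entry z \<notin> C" using F(3) z(2) by force
    ultimately show ?thesis by (simp add: C_def truncate_entry)
  qed
  then show ?thesis using F by blast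
qed

section \<open>Row-finite shift spaces\<close>

lemma window_eq_iff: "window x i k = window y j k \<longleftrightarrow> (\<forall>l<k. x (i + l) = y (j + l))"
  by (auto simp: window_def list_eq_iff_nth_eq)

lemma window_0_eq_iff: "window x 0 (length u) = u \<longleftrightarrow> (\<forall>l<length u. x l = u ! l)"
  by (subst list_eq_iff_nth_eq) (auto simp: window_def)

lemma window_Suc: "window x i (Suc k) = window x i k @ [x (i + k)]"
  by (simp add: window_def)

lemma entry_shift: "entry (shift x) i = entry x (Suc i)"
  by (cases x) (auto simp: nth_tl)

lemma sappend_Nil: "sappend [] z = z"
  by (cases z) auto

lemma sappend_append: "sappend (u @ v) z = sappend u (sappend v z)"
  by (cases z) (auto simp: nth_append fun_eq_iff)

lemma shift_sappend_Cons: "shift (sappend (a # u) z) = sappend u z"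
  by (cases z) auto

lemma sappend_window: "sappend (window x 0 k) (InfSeq (\<lambda>j. x (k + j))) = InfSeq x"
  by (auto simp: window_def)

lemma slength_infinity_iff: "slength z = \<infinity> \<longleftrightarrow> (\<exists>x. z = InfSeq x)"
  by (cases z) auto

lemma slength_0_iff: "slength z = 0 \<longleftrightarrow> z = FinSeq []"
  by (cases z) (auto simp: enat_0_iff)

lemma entry_0_eq_None_iff: "entry z 0 = None \<longleftrightarrow> z = FinSeq []"
  by (cases z) auto

lemma shift_space_in_topspace:
  assumes "shift_space A X" "x \<in> X"
  shows "x \<in> topspace (full_shift A)"
  using assms closedin_subset unfolding shift_space_def by blast

text \<open>Each letter of the prefix is removed by one application of shift invariance.\<close>

lemma shift_space_sappendD:
  assumes "shift_space A X" "sappend v z \<in> X"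
  shows "z \<in> X"
  using assms(2)
proof (induction v)
  case Nil
  then show ?case by (simp add: sappend_Nil)
next
  case (Cons a v)
  then have "shift (sappend (a # v) z) \<in> X" using assms(1) by (auto simp: shift_space_def)
  then show ?case using Cons.IH by (simp only: shift_sappend_Cons)
qed

lemma shift_space_tail:
  assumes "shift_space A X" "InfSeq x \<in> X"
  shows "InfSeq (\<lambda>j. x (k + j)) \<in> X"
  using shift_space_sappendD[OF assms(1)] assms(2) by (metis sappend_window)

lemma shift_space_entry_in:
  assumes "shift_space A X" "InfSeq x \<in> X"
  shows "x i \<in> A"
  using entry_in_alphabet[OF shift_space_in_topspace[OF assms], of i] by simp

lemma window_in_n_blocks:
  assumes "InfSeq x \<in> X"
  shows "window x i k \<in> n_blocks k X"
proof -
  have "window x 0 i @ window x i k = window x 0 (i + k)"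
    using upt_add_eq_append[of 0 i k] by (simp add: window_def)
  then have "sappend (window x 0 i @ window x i k) (InfSeq (\<lambda>j. x (i + k + j))) \<in> X"
    using assms by (simp only: sappend_window)
  moreover have "length (window x i k) = k" by (simp add: window_def)
  ultimately show ?thesis unfolding n_blocks_def blocks_def by blast
qed

text \<open>Closedness in combinatorial form: a point outside \<open>X\<close> would have a whole
  cylinder disjoint from \<open>X\<close>.\<close>

lemma InfSeq_in_shift_spaceI:
  assumes "shift_space A X" "\<And>n. \<exists>z. InfSeq z \<in> X \<and> window z 0 n = window x 0 n"
  shows "InfSeq x \<in> X"
proof (rule ccontr)
  assume not: "InfSeq x \<notin> X"
  \<comment> \<open>The complement of \<open>X\<close> is open only within the full shift, so
    \<open>x\<close> must first be seen to lie there.\<close>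
  have "x i \<in> A" for i
  proof -
    obtain z where z: "InfSeq z \<in> X" "window z 0 (Suc i) = window x 0 (Suc i)"
      using assms(2) by blast
    then have "x i = z i" by (simp add: window_eq_iff)
    then show ?thesis using shift_space_entry_in[OF assms(1) z(1)] by simp
  qed
  then have x: "InfSeq x \<in> topspace (full_shift A) - X"
    using not by (auto simp: InfSeq_in_full_shift)
  have "openin (full_shift A) (topspace (full_shift A) - X)"
    using assms(1) by (auto simp: shift_space_def)
  from openin_contains_cylinder[OF this x] obtain n where
    n: "\<And>z. z \<in> topspace (full_shift A) \<Longrightarrow> (\<forall>i<n. entry z i = Some (x i)) \<Longrightarrow> z \<notin> X"
    by blast
  obtain z where "InfSeq z \<in> X" "window z 0 n = window x 0 n" using assms(2) by blast
  then show False
    using n[of "InfSeq z"] shift_space_in_topspace[OF assms(1)] by (auto simp: window_eq_iff)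
qed

section \<open>Finite points and compactness under row-finiteness\<close>

locale row_finite_shift =
  fixes A :: "'a set" and X :: "'a seq set"
  assumes shift_space: "shift_space A X" and row_finite: "row_finite A X"
begin

text \<open>The infinite-extension property would give infinitely many letters following the last
  letter of a nonempty \<open>u\<close>, against row-finiteness.\<close>

lemma finite_seq_empty:
  assumes "FinSeq u \<in> X"
  shows "u = []"
proof (rule ccontr)
  assume u: "u \<noteq> []"
  have "last u \<in> A"
    using entry_in_alphabet[OF shift_space_in_topspace[OF shift_space assms], of "length u - 1"] u
    by (simp add: last_conv_nth)
  then have "finite {b \<in> A. [last u, b] \<in> blocks X}"
    using row_finite by (auto simp: row_finite_def)
  moreover have "[last u, b] \<in> blocks X" if "sappend (u @ [b]) y \<in> X" for b y
  proof -
    have "u @ [b] = butlast u @ [last u, b]" using u by simp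
    then show ?thesis using that unfolding blocks_def by (metis (mono_tags, lifting) mem_Collect_eq)
  qed
  then have "{a \<in> A. \<exists>y \<in> topspace (full_shift A). sappend (u @ [a]) y \<in> X} \<subseteq>
      {b \<in> A. [last u, b] \<in> blocks X}" by blast
  ultimately have "finite {a \<in> A. \<exists>y \<in> topspace (full_shift A). sappend (u @ [a]) y \<in> X}"
    by (rule finite_subset[rotated])
  then show False using shift_space assms by (auto simp: shift_space_def)
qed

lemma cases_in_X:
  assumes "z \<in> X"
  obtains "z = FinSeq []" | x where "z = InfSeq x"
  using assms finite_seq_empty by (cases z) auto

text \<open>Dropping what precedes an occurrence of \<open>u\<close> leaves a nonempty point of
  \<open>X\<close> starting with \<open>u\<close>, and such a point is infinite.\<close>

lemma nonempty_block_extends: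
  assumes "u \<in> blocks X" "u \<noteq> []"
  shows "\<exists>x. InfSeq x \<in> X \<and> window x 0 (length u) = u"
proof -
  obtain v z where "sappend (v @ u) z \<in> X" using assms(1) by (auto simp: blocks_def)
  then have uz: "sappend u z \<in> X"
    using shift_space_sappendD[OF shift_space] by (simp add: sappend_append)
  show ?thesis
  proof (cases z)
    case (FinSeq w)
    then show ?thesis using uz finite_seq_empty assms(2) by force
  next
    case (InfSeq y)
    then show ?thesis using uz by (force simp: window_0_eq_iff)
  qed
qed

text \<open>The cylinder of \<open>a\<close> in \<open>X\<close> is compact. This is Koenig's lemma on the tree of those words
  starting with \<open>a\<close> on whose cylinder no window determines \<open>g\<close>: row-finiteness makes the tree
  finitely branching, and \<open>g\<close> could not be locally constant along an infinite branch.\<close>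
lemma locally_constant_imp_window_determined:
  fixes g :: "(nat \<Rightarrow> 'a) \<Rightarrow> 'b"
  assumes loc: "\<And>x. InfSeq x \<in> X \<Longrightarrow>
      \<exists>n. \<forall>y. InfSeq y \<in> X \<longrightarrow> window y 0 n = window x 0 n \<longrightarrow> g y = g x"
  shows "\<exists>n\<ge>1. \<forall>x y. InfSeq x \<in> X \<longrightarrow> InfSeq y \<in> X \<longrightarrow> x 0 = a \<longrightarrow>
      window x 0 n = window y 0 n \<longrightarrow> g x = g y"
proof -
  \<comment> \<open>The window of length \<open>n\<close> determines \<open>g\<close> on the
    cylinder of \<open>u\<close>. The tree consists of the words \<open>u\<close> for which this
    fails for every \<open>n\<close>.\<close>
  define det where "det u n \<longleftrightarrow> (\<forall>x y. InfSeq x \<in> X \<longrightarrow> InfSeq y \<in> X \<longrightarrow>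
      window x 0 (length u) = u \<longrightarrow> window x 0 n = window y 0 n \<longrightarrow> g x = g y)" for u n
  \<comment> \<open>If every child of \<open>u\<close> had a determining length, the maximum over
    the finitely many possible next letters would serve for \<open>u\<close>.\<close>
  have step: "\<exists>b. \<forall>n. \<not> det (u @ [b]) n" if u: "u \<noteq> []" "\<forall>n. \<not> det u n" for u
  proof (rule ccontr)
    assume "\<nexists>b. \<forall>n. \<not> det (u @ [b]) n"
    then obtain N where N: "\<And>b. det (u @ [b]) (N b)" by metis
    define S where "S = {b \<in> A. [last u, b] \<in> blocks X}"
    have next_in_S: "last u \<in> A \<and> x (length u) \<in> S"
      if x: "InfSeq x \<in> X" "window x 0 (length u) = u" for x
    proof -
      have l: "x (length u - 1) = last u" using x(2) u(1)
        by (simp add: window_0_eq_iff last_conv_nth)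
      have "window x (length u - 1) 2 \<in> blocks X"
        using window_in_n_blocks[OF x(1)] by (auto simp: n_blocks_def)
      moreover have "window x (length u - 1) 2 = [last u, x (length u)]"
        using l u(1) by (simp add: numeral_2_eq_2 window_Suc) (simp add: window_def)
      ultimately show ?thesis
        using shift_space_entry_in[OF shift_space x(1)] unfolding S_def
        by (metis (mono_tags, lifting) l mem_Collect_eq)
    qed
    \<comment> \<open>On an empty cylinder \<open>det\<close> holds vacuously. A point here shows
      \<open>last u \<in> A\<close>, which row-finiteness requires.\<close>
    have "\<exists>x. InfSeq x \<in> X \<and> window x 0 (length u) = u" using u(2) by (auto simp: det_def)
    then have "finite S" using next_in_S row_finite by (auto simp: S_def row_finite_def)
    then obtain n where n: "\<And>b. b \<in> S \<Longrightarrow> N b \<le> n"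
      using finite_imageI[of S N] unfolding finite_nat_set_iff_bounded_le by auto
    have "det u n"
      unfolding det_def
    proof (intro allI impI)
      fix x y
      assume xy: "InfSeq x \<in> X" "InfSeq y \<in> X" "window x 0 (length u) = u"
        "window x 0 n = window y 0 n"
      have "window x 0 (length (u @ [x (length u)])) = u @ [x (length u)]"
        using xy(3) by (simp add: window_Suc)
      moreover have "window x 0 (N (x (length u))) = window y 0 (N (x (length u)))"
        using n next_in_S[OF xy(1,3)] xy(4) by (force simp: window_eq_iff)
      ultimately show "g x = g y" using N xy(1,2) unfolding det_def by blast
    qed
    then show False using u(2) by blast
  qed
  have "\<exists>n. det [a] n"
  proof (rule ccontr)
    assume "\<nexists>n. det [a] n"
    have "\<exists>f. \<forall>n. (length (f n) = Suc n \<and> (\<forall>m. \<not> det (f n) m)) \<and>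
        (\<exists>b. f (Suc n) = f n @ [b])"
    proof (rule dependent_nat_choice)
      show "\<exists>u. length u = Suc 0 \<and> (\<forall>m. \<not> det u m)"
        using \<open>\<nexists>n. det [a] n\<close> by (intro exI[of _ "[a]"]) simp
    next
      fix u n
      assume u: "length u = Suc n \<and> (\<forall>m. \<not> det u m)"
      then have "u \<noteq> []" by auto
      then obtain b where "\<forall>m. \<not> det (u @ [b]) m" using step u by blast
      then show "\<exists>u'. (length u' = Suc (Suc n) \<and> (\<forall>m. \<not> det u' m)) \<and> (\<exists>b. u' = u @ [b])"
        using u by (intro exI[of _ "u @ [b]"]) simp
    qed
    then obtain f where
      f: "\<And>n. length (f n) = Suc n" "\<And>n m. \<not> det (f n) m" "\<And>n. \<exists>b. f (Suc n) = f n @ [b]"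
      using that by blast
    \<comment> \<open>The words \<open>f n\<close> are nested and \<open>f n\<close> has length
      \<open>n + 1\<close>, so this is the infinite branch.\<close>
    define x where "x i = f i ! i" for i
    have fx: "f n = window x 0 (Suc n)" for n
    proof (induction n)
      case 0
      then show ?case using f(1)[of 0] by (auto simp: x_def window_def length_Suc_conv)
    next
      case (Suc n)
      obtain b where b: "f (Suc n) = f n @ [b]" using f(3) by blast
      then have "x (Suc n) = b" using f(1)[of n] by (simp add: x_def nth_append)
      then show ?case using b Suc by (simp add: window_Suc)
    qed
    have len: "length (window x 0 k) = k" for k by (simp add: window_def)
    \<comment> \<open>Each undetermined word has a nonempty cylinder, so every prefix of
      \<open>x\<close> begins some point of \<open>X\<close>.\<close>
    have "InfSeq x \<in> X"
    proof (rule InfSeq_in_shift_spaceI[OF shift_space])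
      fix n
      obtain z where "InfSeq z \<in> X" "window z 0 (Suc n) = window x 0 (Suc n)"
        using f(2)[of n 0] unfolding det_def fx len by blast
      then show "\<exists>z. InfSeq z \<in> X \<and> window z 0 n = window x 0 n" by (auto simp: window_eq_iff)
    qed
    then obtain n where
      n: "\<And>y. InfSeq y \<in> X \<Longrightarrow> window y 0 n = window x 0 n \<Longrightarrow> g y = g x"
      using loc by blast
    \<comment> \<open>Points of the cylinder of \<open>f n\<close> agree with \<open>x\<close> on
      its first \<open>n\<close> letters, where local constancy at \<open>x\<close> applies.\<close>
    have "det (f n) n"
      unfolding det_def fx len
    proof (intro allI impI)
      fix z y
      assume zy: "InfSeq z \<in> X" "InfSeq y \<in> X" "window z 0 (Suc n) = window x 0 (Suc n)"
        "window z 0 n = window y 0 n"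
      have "window z 0 n = window x 0 n" using zy(3) by (simp add: window_eq_iff)
      then show "g z = g y" using n zy by metis
    qed
    then show False using f(2) by blast
  qed
  then obtain n where n: "det [a] n" by blast
  \<comment> \<open>The maximum with 1 supplies the positive block length that a local rule
    demands.\<close>
  have "g x = g y" if "InfSeq x \<in> X" "InfSeq y \<in> X" "x 0 = a"
    "window x 0 (max 1 n) = window y 0 (max 1 n)" for x y
  proof -
    have "window x 0 n = window y 0 n" using that(4) by (simp add: window_eq_iff)
    moreover have "window x 0 (length [a]) = [a]" using that(3) by (simp add: window_def)
    ultimately show ?thesis using n that(1,2) unfolding det_def by blast
  qed
  then show ?thesis by (intro exI[of _ "max 1 n"]) auto
qed

section \<open>Morphisms and sliding block codes\<close>

lemma morphism_length:
  assumes "shift_morphism A X Y \<phi>" "InfSeq x \<in> X"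
  shows "\<exists>y. \<phi> (InfSeq x) = InfSeq y"
  using assms by (auto simp: shift_morphism_def slength_infinity_iff)

text \<open>Commuting with the shift reduces every entry of the image to a first entry.\<close>

lemma morphism_entry:
  assumes "shift_morphism A X Y \<phi>" "InfSeq x \<in> X"
  shows "entry (\<phi> (InfSeq x)) i = entry (\<phi> (InfSeq (\<lambda>j. x (i + j)))) 0"
  using assms(2)
proof (induction i arbitrary: x)
  case (Suc i)
  have x: "InfSeq (\<lambda>j. x (Suc j)) \<in> X"
    using shift_space_tail[OF shift_space Suc.prems, of 1] by simp
  have "entry (\<phi> (InfSeq x)) (Suc i) = entry (shift (\<phi> (InfSeq x))) i" by (simp add: entry_shift)
  also have "shift (\<phi> (InfSeq x)) = \<phi> (InfSeq (\<lambda>j. x (Suc j)))"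
    using assms(1) Suc.prems unfolding shift_morphism_def by (metis shift.simps(2))
  finally show ?case using Suc.IH[OF x] by simp
qed simp

text \<open>Fixing the first entry is an open condition on the image, so its preimage contains a
  cylinder around \<open>x\<close>.\<close>

lemma morphism_first_entry_locally_constant:
  assumes "shift_morphism A X Y \<phi>" "shift_space A Y" "\<phi> \<in> X \<rightarrow> Y" "InfSeq x \<in> X"
  shows "\<exists>n. \<forall>y. InfSeq y \<in> X \<longrightarrow> window y 0 n = window x 0 n \<longrightarrow>
    entry (\<phi> (InfSeq y)) 0 = entry (\<phi> (InfSeq x)) 0"
proof -
  let ?T = "full_shift A"
  obtain y where y: "\<phi> (InfSeq x) = InfSeq y" using morphism_length assms(1,4) by blast
  have "InfSeq y \<in> Y" using funcset_mem[OF assms(3,4)] y by simp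
  then have "y 0 \<in> A" by (rule shift_space_entry_in[OF assms(2)])
  then have "openin (subtopology ?T Y) (Y \<inter> {z \<in> topspace ?T. entry z 0 = Some (y 0)})"
    by (intro openin_subtopology_Int2 openin_entry_eq)
  moreover have "continuous_map (subtopology ?T X) (subtopology ?T Y) \<phi>"
    using assms(1) by (simp add: shift_morphism_def)
  ultimately have "openin (subtopology ?T X) {z \<in> topspace (subtopology ?T X).
      \<phi> z \<in> Y \<inter> {z \<in> topspace ?T. entry z 0 = Some (y 0)}}"
    by (rule openin_continuous_map_preimage[rotated])
  then obtain U where U: "openin ?T U" "{z \<in> topspace (subtopology ?T X).
      \<phi> z \<in> Y \<inter> {z \<in> topspace ?T. entry z 0 = Some (y 0)}} = U \<inter> X"
    unfolding openin_subtopology by blast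
  have "InfSeq x \<in> U \<inter> X"
    using y \<open>InfSeq y \<in> Y\<close> assms(4) shift_space_in_topspace[OF shift_space]
      shift_space_in_topspace[OF assms(2)]
    by (auto simp flip: U(2))
  then have "InfSeq x \<in> U" by blast
  from openin_contains_cylinder[OF U(1) this] obtain n
    where n: "\<And>z. z \<in> topspace ?T \<Longrightarrow> (\<forall>i<n. entry z i = Some (x i)) \<Longrightarrow> z \<in> U" by blast
  have "entry (\<phi> (InfSeq z)) 0 = entry (\<phi> (InfSeq x)) 0"
    if z: "InfSeq z \<in> X" "window z 0 n = window x 0 n" for z
  proof -
    have "InfSeq z \<in> U \<inter> X"
      using z n[of "InfSeq z"] shift_space_in_topspace[OF shift_space z(1)]
      by (auto simp: window_eq_iff)
    then have "entry (\<phi> (InfSeq z)) 0 = Some (y 0)" unfolding U(2)[symmetric] by blast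
    then show ?thesis using y by simp
  qed
  then show ?thesis by blast
qed

lemma morphism_local_rule:
  assumes "shift_morphism A X Y \<phi>" "shift_space A Y" "\<phi> \<in> X \<rightarrow> Y"
  shows "\<exists>n \<Phi>. local_rule A X \<phi> n \<Phi>"
proof -
  let ?g = "\<lambda>x. entry (\<phi> (InfSeq x)) 0"
  have "\<exists>n\<ge>1. \<forall>x y. InfSeq x \<in> X \<longrightarrow> InfSeq y \<in> X \<longrightarrow> x 0 = a \<longrightarrow>
      window x 0 n = window y 0 n \<longrightarrow> ?g x = ?g y" for a
    using morphism_first_entry_locally_constant[OF assms]
    by (intro locally_constant_imp_window_determined)
  then obtain n where n: "\<And>a. n a \<ge> 1"
    and g: "\<And>a x y. \<lbrakk>InfSeq x \<in> X; InfSeq y \<in> X; x 0 = a; window x 0 (n a) = window y 0 (n a)\<rbrakk>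
      \<Longrightarrow> ?g x = ?g y"
    by metis
  \<comment> \<open>\<open>e u\<close> is a chosen point of \<open>X\<close> beginning with
    \<open>u\<close>; the rule takes its value on \<open>u\<close> from this representative.\<close>
  define e where "e u = (SOME x. InfSeq x \<in> X \<and> window x 0 (length u) = u)" for u
  have e: "InfSeq (e u) \<in> X \<and> window (e u) 0 (length u) = u" if "u \<in> blocks X" "u \<noteq> []" for u
    unfolding e_def by (rule someI_ex[OF nonempty_block_extends[OF that]])
  \<comment> \<open>The letter \<open>a\<close> influences the rule only through the block length
    \<open>n a\<close>.\<close>
  define \<Phi> where "\<Phi> a u = the (?g (e u))" for a :: 'a and u
  have gA: "\<exists>b \<in> A. ?g x = Some b" if x: "InfSeq x \<in> X" for x
  proof -
    obtain y where y: "\<phi> (InfSeq x) = InfSeq y" using morphism_length[OF assms(1) x] by blast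
    then have "InfSeq y \<in> Y" using funcset_mem[OF assms(3) x] by simp
    then show ?thesis using y shift_space_entry_in[OF assms(2)] by simp
  qed
  have "\<Phi> a u \<in> A" if "u \<in> n_blocks (n a) X" for a u
  proof -
    have "u \<in> blocks X" "u \<noteq> []" using that n[of a] by (auto simp: n_blocks_def)
    then have "InfSeq (e u) \<in> X" using e by blast
    then show ?thesis using gA unfolding \<Phi>_def by fastforce
  qed
  moreover have "entry (\<phi> (InfSeq x)) i = Some (\<Phi> (x i) (window x i (n (x i))))"
    if x: "InfSeq x \<in> X" for x i
  proof -
    let ?x = "\<lambda>j. x (i + j)" and ?u = "window x i (n (x i))"
    have x': "InfSeq ?x \<in> X" by (rule shift_space_tail[OF shift_space x])
    have u: "?u \<in> blocks X" "length ?u = n (x i)"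
      using window_in_n_blocks[OF x] by (auto simp: n_blocks_def)
    then have "?u \<noteq> []" using n[of "x i"] by auto
    then have e': "InfSeq (e ?u) \<in> X" "window (e ?u) 0 (n (x i)) = ?u"
      using e[OF u(1)] u(2) by simp_all
    \<comment> \<open>The shifted point and the representative share the window that determines the
      first entry, so the choice of representative is immaterial.\<close>
    have "?g ?x = ?g (e ?u)"
      using e' x' by (intro g[of _ _ "x i"]) (auto simp: window_eq_iff)
    moreover obtain b where "?g ?x = Some b" using gA[OF x'] by blast
    ultimately have "?g ?x = Some (\<Phi> (x i) ?u)" unfolding \<Phi>_def by (metis option.sel)
    then show ?thesis using morphism_entry[OF assms(1) x, of i] by simp
  qed
  ultimately have "local_rule A X \<phi> n \<Phi>" using n by (auto simp: local_rule_def)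
  then show ?thesis by blast
qed

lemma morphism_preserves_limits_to_empty:
  assumes "shift_morphism A X Y \<phi>"
  shows "preserves_limits_to_empty A X \<phi>"
  unfolding preserves_limits_to_empty_def
proof (intro allI impI)
  fix xs :: "nat \<Rightarrow> 'a seq"
  assume xs: "range xs \<subseteq> X" "limitin (full_shift A) xs (FinSeq []) sequentially"
  \<comment> \<open>Closedness of \<open>X\<close> contains the limit, so continuity of
    \<open>\<phi>\<close> applies at it; preservation of length then identifies its image.\<close>
  have X: "FinSeq [] \<in> X"
    using limitin_closedin[OF xs(2), of X] xs(1) shift_space
    by (auto simp: shift_space_def image_subset_iff)
  then have "limitin (subtopology (full_shift A) X) xs (FinSeq []) sequentially"
    using xs by (auto simp: limitin_subtopology image_subset_iff)
  then have "limitin (subtopology (full_shift A) Y) (\<phi> \<circ> xs) (\<phi> (FinSeq [])) sequentially"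
    using assms unfolding shift_morphism_def by (blast intro: continuous_map_limit)
  moreover have "slength (\<phi> (FinSeq [])) = 0"
    using assms X by (simp add: shift_morphism_def zero_enat_def)
  then have "\<phi> (FinSeq []) = FinSeq []" by (simp add: slength_0_iff)
  ultimately show "limitin (full_shift A) (\<lambda>n. \<phi> (xs n)) (FinSeq []) sequentially"
    by (simp add: limitin_subtopology o_def)
qed

section \<open>From codes to morphisms\<close>

text \<open>Applied to the constant sequence, condition (a) puts the image in every neighbourhood of
  the empty sequence. If the image began with \<open>b\<close>, the neighbourhood avoiding
  \<open>b\<close> would exclude it.\<close>

lemma code_maps_empty:
  assumes "preserves_limits_to_empty A X \<phi>" "FinSeq [] \<in> X"
  shows "\<phi> (FinSeq []) = FinSeq []"
proof (rule ccontr)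
  assume not: "\<phi> (FinSeq []) \<noteq> FinSeq []"
  have T: "FinSeq [] \<in> topspace (full_shift A)"
    by (rule shift_space_in_topspace[OF shift_space assms(2)])
  then have "limitin (full_shift A) (\<lambda>n. \<phi> (FinSeq [])) (FinSeq []) sequentially"
    using assms(1)[unfolded preserves_limits_to_empty_def, rule_format, of "\<lambda>n. FinSeq []"] assms(2)
    by auto
  then have lim: "\<phi> (FinSeq []) \<in> U" if "openin (full_shift A) U" "FinSeq [] \<in> U" for U
    using limitinD that by fastforce
  obtain b where b: "entry (\<phi> (FinSeq [])) 0 = Some b"
    using not entry_0_eq_None_iff by (cases "entry (\<phi> (FinSeq [])) 0") auto
  have "\<phi> (FinSeq []) \<in> topspace (full_shift A)" using lim T by blast
  then have "b \<in> A" using b by (rule entry_in_alphabet)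
  moreover have "infinite A" using T by (auto simp: topspace_full_shift_finite)
  ultimately have "openin (full_shift A) {z \<in> topspace (full_shift A). entry z 0 \<notin> Some ` {b}}"
    by (intro openin_first_entry_avoids) auto
  then show False using lim b T by fastforce
qed

lemma local_rule_maps_InfSeq:
  assumes "local_rule A X \<phi> n \<Phi>" "InfSeq x \<in> X"
  shows "\<phi> (InfSeq x) = InfSeq (\<lambda>i. \<Phi> (x i) (window x i (n (x i))))"
  using assms by (intro seq_eqI) (auto simp: local_rule_def)

lemma code_continuous_at_InfSeq:
  assumes "local_rule A X \<phi> n \<Phi>" "openin (full_shift A) U" "InfSeq x \<in> X" "\<phi> (InfSeq x) \<in> U"
    and "\<phi> ` X \<subseteq> topspace (full_shift A)"
  shows "\<exists>V. openin (full_shift A) V \<and> InfSeq x \<in> V \<and> \<phi> ` (V \<inter> X) \<subseteq> U"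
proof -
  let ?F = "\<lambda>x i. \<Phi> (x i) (window x i (n (x i)))"
  have "InfSeq (?F x) \<in> U" using assms(4) local_rule_maps_InfSeq[OF assms(1,3)] by simp
  from openin_contains_cylinder[OF assms(2) this] obtain k where
    k: "\<And>z. z \<in> topspace (full_shift A) \<Longrightarrow> (\<forall>i<k. entry z i = Some (?F x i)) \<Longrightarrow> z \<in> U" by blast
  \<comment> \<open>The sum bounds the reach of the first \<open>k\<close> windows. The successor
    keeps \<open>m\<close> positive even for \<open>k = 0\<close>, so the cylinder fixes a first
    letter and excludes the empty sequence.\<close>
  define m where "m = Suc (\<Sum>i<k. i + n (x i))"
  have m: "i + n (x i) < m" if "i < k" for i
    unfolding m_def less_Suc_eq_le by (rule member_le_sum) (use that in auto)
  define V where "V = {z \<in> topspace (full_shift A). \<forall>i<m. entry z i = Some (x i)}"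
  have "\<phi> z \<in> U" if z: "z \<in> V" "z \<in> X" for z
  proof -
    have "entry z 0 = Some (x 0)" using z(1) by (simp add: V_def m_def)
    then obtain y where y: "z = InfSeq y" using z(2) by (elim cases_in_X) auto
    then have "\<forall>i<m. y i = x i" using z(1) by (simp add: V_def)
    moreover have "i < m" if "i < k" for i using m[OF that] by simp
    ultimately have "?F y i = ?F x i" if "i < k" for i
      using m[OF that] that by (auto simp: window_def intro!: arg_cong[where f = "\<Phi> (x i)"])
    moreover have "\<phi> z = InfSeq (?F y)" using y z(2) local_rule_maps_InfSeq[OF assms(1)] by blast
    moreover have "\<phi> z \<in> topspace (full_shift A)" using assms(5) z(2) by blast
    ultimately show ?thesis by (intro k) simp_all
  qed
  moreover have "openin (full_shift A) V"
    unfolding V_def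
    by (rule openin_cylinder) (use shift_space_entry_in[OF shift_space assms(3)] in auto)
  moreover have "InfSeq x \<in> V"
    using shift_space_in_topspace[OF shift_space assms(3)] by (simp add: V_def)
  ultimately show ?thesis by blast
qed

text \<open>Countability of the alphabet makes the empty sequence have a countable neighbourhood base, so
  that condition (a) on sequences is continuity there.\<close>
lemma code_continuous_at_empty:
  assumes "countable A" "preserves_limits_to_empty A X \<phi>" "openin (full_shift A) U"
    and "FinSeq [] \<in> X" "FinSeq [] \<in> U"
  shows "\<exists>V. openin (full_shift A) V \<and> FinSeq [] \<in> V \<and> \<phi> ` (V \<inter> X) \<subseteq> U"
proof -
  let ?T = "full_shift A"
  have T: "FinSeq [] \<in> topspace ?T" by (rule shift_space_in_topspace[OF shift_space assms(4)])
  then have inf: "infinite A" by (auto simp: topspace_full_shift_finite)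
  \<comment> \<open>The first \<open>k\<close> letters of an enumeration of \<open>A\<close>;
    avoiding them gives the decreasing neighbourhood base \<open>V k\<close>.\<close>
  define F where "F k = from_nat_into A ` {..<k}" for k
  have F: "finite (F k)" "F k \<subseteq> A" for k
    using inf by (auto simp: F_def intro!: from_nat_into)
  define V where "V k = {z \<in> topspace ?T. entry z 0 \<notin> Some ` F k}" for k
  have V: "openin ?T (V k)" "FinSeq [] \<in> V k" for k
    using openin_first_entry_avoids[OF inf F] T by (auto simp: V_def)
  have "\<exists>k. \<phi> ` (V k \<inter> X) \<subseteq> U"
  proof (rule ccontr)
    assume "\<nexists>k. \<phi> ` (V k \<inter> X) \<subseteq> U"
    then have "\<forall>k. \<exists>z. z \<in> V k \<and> z \<in> X \<and> \<phi> z \<notin> U" by blast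
    then obtain z where z: "\<And>k. z k \<in> V k" "\<And>k. z k \<in> X" "\<And>k. \<phi> (z k) \<notin> U" by metis
    have "limitin ?T z (FinSeq []) sequentially"
      unfolding limitin_sequentially
    proof (intro conjI allI impI T)
      fix W
      assume "openin ?T W \<and> FinSeq [] \<in> W"
      then obtain G where G: "finite G" "G \<subseteq> A"
        "\<And>z. z \<in> topspace ?T \<Longrightarrow> entry z 0 \<notin> Some ` G \<Longrightarrow> z \<in> W"
        using openin_contains_empty by metis
      \<comment> \<open>From index \<open>N\<close> on, \<open>F k\<close> contains all of
        \<open>G\<close>, so \<open>z k\<close> avoids \<open>G\<close> in its first entry.\<close>
      obtain N where N: "to_nat_on A ` G \<subseteq> {..<N}"
        using finite_nat_iff_bounded G(1) by blast
      have "z k \<in> W" if "N \<le> k" for k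
      proof (rule G(3))
        have "g \<in> F k" if "g \<in> G" for g
        proof -
          have "from_nat_into A (to_nat_on A g) = g" "to_nat_on A g < k"
            using that G(2) N \<open>N \<le> k\<close> assms(1) by (auto simp: subset_iff image_subset_iff)
          then show ?thesis unfolding F_def by (metis image_eqI lessThan_iff)
        qed
        then show "entry (z k) 0 \<notin> Some ` G" using z(1)[of k] by (auto simp: V_def)
        show "z k \<in> topspace ?T" using z(1)[of k] by (simp add: V_def)
      qed
      then show "\<exists>N. \<forall>k\<ge>N. z k \<in> W" by blast
    qed
    then have "limitin ?T (\<lambda>k. \<phi> (z k)) (FinSeq []) sequentially"
      using assms(2) z(2) unfolding preserves_limits_to_empty_def by blast
    then show False using z(3) assms(3,5) unfolding limitin_sequentially by blast
  qed
  then show ?thesis using V by blast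
qed

lemma code_imp_morphism:
  assumes "countable A" "shift_space A Y" "\<phi> \<in> X \<rightarrow> Y" "sliding_block_code A X \<phi>"
  shows "shift_morphism A X Y \<phi>"
proof -
  let ?T = "full_shift A"
  obtain n \<Phi> where rule: "local_rule A X \<phi> n \<Phi>" and lim: "preserves_limits_to_empty A X \<phi>"
    using assms(4) by (auto simp: sliding_block_code_def)
  have Y: "Y \<subseteq> topspace ?T" using shift_space_in_topspace[OF assms(2)] by blast
  have XT: "topspace (subtopology ?T X) = X"
    using shift_space_in_topspace[OF shift_space] by auto
  have \<phi>Y: "\<phi> ` X \<subseteq> Y" using assms(3) by blast
  have nbhd: "\<exists>V. openin ?T V \<and> x \<in> V \<and> \<phi> ` (V \<inter> X) \<subseteq> U"
    if "x \<in> X" "openin ?T U" "\<phi> x \<in> U" for x U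
    using that(1)
  proof (cases rule: cases_in_X)
    case 1
    then show ?thesis
      using that code_continuous_at_empty[OF assms(1) lim] code_maps_empty[OF lim] by metis
  next
    case (2 y)
    then show ?thesis using that code_continuous_at_InfSeq[OF rule] \<phi>Y Y by blast
  qed
  have "continuous_map (subtopology ?T X) ?T \<phi>"
    unfolding continuous_map_def XT
  proof (intro conjI allI impI)
    show "\<phi> \<in> X \<rightarrow> topspace ?T" using \<phi>Y Y by blast
    fix U
    assume U: "openin ?T U"
    show "openin (subtopology ?T X) {x \<in> X. \<phi> x \<in> U}"
    proof (subst openin_subopen, intro ballI)
      fix x
      assume "x \<in> {x \<in> X. \<phi> x \<in> U}"
      then obtain V where V: "openin ?T V" "x \<in> V" "x \<in> X" "\<phi> ` (V \<inter> X) \<subseteq> U"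
        using nbhd[of x U] U by blast
      then have "openin (subtopology ?T X) (V \<inter> X)" by (intro openin_subtopology_Int)
      then show "\<exists>W. openin (subtopology ?T X) W \<and> x \<in> W \<and> W \<subseteq> {x \<in> X. \<phi> x \<in> U}"
        using V by (intro exI[of _ "V \<inter> X"]) auto
    qed
  qed
  then have "continuous_map (subtopology ?T X) (subtopology ?T Y) \<phi>"
    using \<phi>Y by (auto simp: continuous_map_in_subtopology XT)
  moreover have "\<phi> (shift x) = shift (\<phi> x) \<and> slength (\<phi> x) = slength x" if "x \<in> X" for x
    using that
  proof (cases rule: cases_in_X)
    case 1
    then show ?thesis using that code_maps_empty[OF lim] by simp
  next
    case (2 y)
    have "InfSeq (\<lambda>i. y (Suc i)) \<in> X"
      using shift_space_tail[OF shift_space, of y 1] that 2 by simp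
    \<comment> \<open>The rule depends on the letters of a window and not on its position, hence it
      commutes with the shift.\<close>
    moreover have "window (\<lambda>i. y (Suc i)) i k = window y (Suc i) k" for i k
      by (simp add: window_eq_iff)
    ultimately show ?thesis using that 2 by (simp add: local_rule_maps_InfSeq[OF rule])
  qed
  ultimately show ?thesis by (simp add: shift_morphism_def)
qed

section \<open>Bounded codes\<close>

lemma bounded_imp_block_code:
  assumes "bounded_sliding_block_code A X \<phi>"
  shows "\<exists>M\<ge>1. block_code A X M \<phi>"
proof -
  obtain n \<Phi> M where lim: "preserves_limits_to_empty A X \<phi>" and rule: "local_rule A X \<phi> n \<Phi>"
    and M: "M \<ge> 1" "\<And>a. a \<in> A \<Longrightarrow> n a \<le> M"
    using assms by (auto simp: bounded_sliding_block_code_def)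
  \<comment> \<open>The first letter of an \<open>M\<close>-block selects the rule, which then reads
    only as many letters as it needs.\<close>
  define \<Psi> where "\<Psi> u = \<Phi> (hd u) (take (n (hd u)) u)" for u
  have window: "\<Psi> (window x i M) = \<Phi> (x i) (window x i (n (x i)))" if "InfSeq x \<in> X" for x i
  proof -
    have "hd (window x i M) = x i" using M(1) by (simp add: window_def hd_map)
    moreover have "n (x i) \<le> M" using M(2) shift_space_entry_in[OF shift_space that] by blast
    then have "take (n (x i)) (window x i M) = window x i (n (x i))"
      by (simp add: window_def take_map)
    ultimately show ?thesis by (simp add: \<Psi>_def)
  qed
  \<comment> \<open>Extending \<open>u\<close> to an infinite point shows that its truncation is a
    block of \<open>X\<close> beginning with the right letter, which is where \<open>\<Phi>\<close>
    is known to take values in \<open>A\<close>.\<close>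
  have "\<Psi> u \<in> A" if "u \<in> n_blocks M X" for u
  proof -
    have u: "u \<in> blocks X" "length u = M" "u \<noteq> []" using that M(1) by (auto simp: n_blocks_def)
    then obtain x where x: "InfSeq x \<in> X" "window x 0 M = u"
      using nonempty_block_extends by blast
    have "x 0 \<in> A" by (rule shift_space_entry_in[OF shift_space x(1)])
    moreover have "n (x 0) \<ge> 1" using rule \<open>x 0 \<in> A\<close> by (simp add: local_rule_def)
    then have "hd (window x 0 (n (x 0))) = x 0" by (simp add: window_def hd_map)
    ultimately have "\<Phi> (x 0) (window x 0 (n (x 0))) \<in> A"
      using rule window_in_n_blocks[OF x(1), of 0 "n (x 0)"] unfolding local_rule_def by blast
    then show ?thesis using window[OF x(1), of 0] x(2) by simp
  qed
  moreover have "entry (\<phi> (InfSeq x)) i = Some (\<Psi> (window x i M))" if "InfSeq x \<in> X" for x i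
    using that window local_rule_maps_InfSeq[OF rule] by simp
  moreover have "sliding_block_code A X \<phi>" using lim rule by (auto simp: sliding_block_code_def)
  ultimately have "block_code A X M \<phi>" unfolding block_code_def by blast
  then show ?thesis using M(1) by blast
qed

end

theorem theorem7p6:
  fixes A :: "'a set" and X Y :: "'a seq set" and \<phi> :: "'a seq \<Rightarrow> 'a seq"
  assumes "countable A"
    and "shift_space A X"
    and "shift_space A Y"
    and "row_finite A X"
    and "\<phi> \<in> X \<rightarrow> Y"
  shows "(shift_morphism A X Y \<phi> \<longleftrightarrow> sliding_block_code A X \<phi>) \<and>
    (bounded_sliding_block_code A X \<phi> \<longrightarrow> (\<exists>M \<ge> 1. block_code A X M \<phi>))"
proof -
  interpret row_finite_shift A X using assms(2,4) by unfold_locales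
  have "sliding_block_code A X \<phi>" if "shift_morphism A X Y \<phi>"
    using morphism_preserves_limits_to_empty[OF that] morphism_local_rule[OF that assms(3,5)]
    by (simp add: sliding_block_code_def)
  then show ?thesis using code_imp_morphism[OF assms(1,3,5)] bounded_imp_block_code by blast
qed

end
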